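(* Let $\gamma \geq 2$ and $n \geq 3\gamma$ be integers. Let $\mathcal{G}_{n,\gamma}$ be the set of all simple graphs without isolated vertices having order $n$, domination number $\gamma$, and exactly one minimum dominating set. Then there exists a perfectly dominated graph $G \in \mathcal{G}_{n,\gamma}$ with exactly $$\binom{n-\gamma}{2} - \gamma(\gamma-2)$$ edges.
   Context: A dominating set of a graph $G=(V,E)$ is a set $D\subseteq V$ such that every vertex of $V\setminus D$ is adjacent to some vertex of $D$; the domination number $\gamma(G)$ is the minimum size of a dominating set, and a minimum dominating set is one of size $\gamma(G)$. A simple graph $G$ without isolated vertices, of order $n$ and domination number $\gamma$, is perfectly dominated if it has a minimum dominating set $D$ with $\sum_{x\in D}\deg(x) = n-\gamma$ (equivalently, $D$ is independent and every vertex outside $D$ is adjacent to exactly one vertex of $D$). *)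

theory Defs
  imports Main
begin

definition simple_graph :: "'a set \<Rightarrow> 'a set set \<Rightarrow> bool" where
  "simple_graph V E \<longleftrightarrow> finite V \<and> E \<subseteq> {e. e \<subseteq> V \<and> card e = 2}"

definition degree :: "'a set \<Rightarrow> 'a set set \<Rightarrow> 'a \<Rightarrow> nat" where
  "degree V E x = card {y \<in> V. {x, y} \<in> E}"

definition no_isolated_vertices :: "'a set \<Rightarrow> 'a set set \<Rightarrow> bool" where
  "no_isolated_vertices V E \<longleftrightarrow> (\<forall>x\<in>V. \<exists>y\<in>V. {x, y} \<in> E)"

definition dominating_set :: "'a set \<Rightarrow> 'a set set \<Rightarrow> 'a set \<Rightarrow> bool" where
  "dominating_set V E D \<longleftrightarrow> D \<subseteq> V \<and> (\<forall>v \<in> V - D. \<exists>u\<in>D. {u, v} \<in> E)"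

definition domination_number :: "'a set \<Rightarrow> 'a set set \<Rightarrow> nat" where
  "domination_number V E = Min (card ` {D. dominating_set V E D})"

definition minimum_dominating_set :: "'a set \<Rightarrow> 'a set set \<Rightarrow> 'a set \<Rightarrow> bool" where
  "minimum_dominating_set V E D \<longleftrightarrow>
     dominating_set V E D \<and> card D = domination_number V E"

text \<open>Since \<open>V\<close> is itself a dominating set, the domination number is at most \<open>card V\<close>,
  so the subtraction on \<open>nat\<close> below does not truncate.\<close>

definition perfectly_dominated :: "'a set \<Rightarrow> 'a set set \<Rightarrow> bool" where
  "perfectly_dominated V E \<longleftrightarrow>
     simple_graph V E \<and> no_isolated_vertices V E \<and>
     (\<exists>D. minimum_dominating_set V E D \<and>
          (\<Sum>x\<in>D. degree V E x) = card V - domination_number V E)"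

definition unique_mds_graphs :: "nat \<Rightarrow> nat \<Rightarrow> ('a set \<times> 'a set set) set" where
  "unique_mds_graphs n \<gamma> =
     {(V, E). simple_graph V E \<and> no_isolated_vertices V E \<and>
        card V = n \<and> domination_number V E = \<gamma> \<and>
        (\<exists>!D. minimum_dominating_set V E D)}"

end

theory Submission
  imports Defs
begin

text \<open>
  The vertices are \<open>x\<^sub>i\<close>, \<open>c\<^sub>i\<close> (\<open>i < \<gamma>\<close>) and \<open>l\<^sub>t\<close> (\<open>t < n - 2\<gamma>\<close>). The \<open>x\<^sub>i\<close> are the centers of
  disjoint stars covering the graph, where \<open>c\<^sub>i\<close> belongs to star \<open>i\<close> and \<open>l\<^sub>t\<close> to star
  \<open>min t (\<gamma> - 1)\<close>. In addition the \<open>l\<^sub>t\<close> form a clique, and \<open>c\<^sub>i\<close> is joined to \<open>l\<^sub>t\<close> iff \<open>l\<^sub>t\<close>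
  belongs to a star of index greater than \<open>i\<close>. A dominating set must meet the closed neighbourhood
  of every \<open>x\<^sub>i\<close>, so a minimum one contains exactly one vertex of every star. Rank the leaves by
  putting the \<open>l\<^sub>t\<close> first, in decreasing order of their stars, followed by \<open>c\<^sub>0, c\<^sub>1, \<dots>\<close>. Every
  leaf then has a twin in its star, all of whose neighbours other than the center have smaller
  rank: the twin of \<open>l\<^sub>t\<close> is the \<open>c\<^sub>i\<close> in its star, the twin of \<open>c\<^sub>i\<close> is \<open>l\<^sub>i\<close>. If a minimum
  dominating set contains a leaf, then the twin of its leaf of least rank is not dominated.
\<close>

section \<open>Efficient domination\<close>

text \<open>The closed neighbourhoods of the vertices in \<open>D\<close> are the fibres of \<open>center\<close>, so they partition \<open>V\<close>.\<close>

locale efficient_domination =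
  fixes V :: "'a set" and E :: "'a set set" and D :: "'a set" and center :: "'a \<Rightarrow> 'a"
  assumes finite_V: "finite V"
    and D_subset_V: "D \<subseteq> V"
    and center_in_D: "v \<in> V \<Longrightarrow> center v \<in> D"
    and center_of_D: "u \<in> D \<Longrightarrow> center u = u"
    and adjacent_D_iff: "u \<in> D \<Longrightarrow> v \<in> V \<Longrightarrow> {u, v} \<in> E \<longleftrightarrow> v \<notin> D \<and> center v = u"
begin

lemma dominating_set_D: "dominating_set V E D"
  using D_subset_V center_in_D adjacent_D_iff by (auto simp: dominating_set_def)

lemma center_image_dominating_set:
  assumes "dominating_set V E S"
  shows "center ` S = D"
proof
  have "S \<subseteq> V" and dominated: "\<And>v. v \<in> V - S \<Longrightarrow> \<exists>u\<in>S. {u, v} \<in> E"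
    using assms by (auto simp: dominating_set_def)
  show "center ` S \<subseteq> D"
    using \<open>S \<subseteq> V\<close> center_in_D by auto
  show "D \<subseteq> center ` S"
  proof
    fix x assume "x \<in> D"
    show "x \<in> center ` S"
    proof (cases "x \<in> S")
      case True
      then show ?thesis using center_of_D[OF \<open>x \<in> D\<close>] by force
    next
      case False
      then obtain u where "u \<in> S" "{x, u} \<in> E"
        using dominated[of x] \<open>x \<in> D\<close> D_subset_V by (auto simp: insert_commute)
      then show ?thesis using adjacent_D_iff[OF \<open>x \<in> D\<close>] \<open>S \<subseteq> V\<close> by auto
    qed
  qed
qed

lemma finite_dominating_set: "dominating_set V E S \<Longrightarrow> finite S"
  using finite_V finite_subset by (auto simp: dominating_set_def)

lemma card_D_le_dominating_set: "dominating_set V E S \<Longrightarrow> card D \<le> card S"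
  using center_image_dominating_set finite_dominating_set card_image_le by metis

lemma domination_number_eq: "domination_number V E = card D"
  unfolding domination_number_def
proof (rule Min_eqI)
  have "{S. dominating_set V E S} \<subseteq> Pow V"
    by (auto simp: dominating_set_def)
  then show "finite (card ` {S. dominating_set V E S})"
    using finite_V finite_subset by blast
qed (use card_D_le_dominating_set dominating_set_D in auto)

lemma minimum_dominating_set_D: "minimum_dominating_set V E D"
  by (simp add: minimum_dominating_set_def dominating_set_D domination_number_eq)

lemma inj_on_center_minimum_dominating_set:
  assumes "minimum_dominating_set V E S"
  shows "inj_on center S"
  using assms center_image_dominating_set finite_dominating_set
  by (intro eq_card_imp_inj_on) (auto simp: minimum_dominating_set_def domination_number_eq)

definition lower_twin :: "('a \<Rightarrow> 'b::order) \<Rightarrow> 'a \<Rightarrow> 'a \<Rightarrow> bool" where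
  "lower_twin rank s t \<longleftrightarrow> t \<in> V - D \<and> t \<noteq> s \<and> center t = center s \<and>
     (\<forall>u\<in>V - D. {u, t} \<in> E \<longrightarrow> rank u < rank s)"

lemma minimum_dominating_set_unique:
  fixes rank :: "'a \<Rightarrow> 'b::order"
  assumes ex_lower_twin: "\<And>s. s \<in> V - D \<Longrightarrow> \<exists>t. lower_twin rank s t"
    and mds: "minimum_dominating_set V E S"
  shows "S = D"
proof -
  have dom: "dominating_set V E S" and card_eq: "card S = card D"
    using mds by (auto simp: minimum_dominating_set_def domination_number_eq)
  have "S \<subseteq> V"
    using dom by (simp add: dominating_set_def)
  have "S - D = {}"
  proof (rule ccontr)
    assume "S - D \<noteq> {}"
    then obtain s where s_in: "s \<in> S - D" and least: "\<And>u. u \<in> S - D \<Longrightarrow> \<not> rank u < rank s"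
      using arg_min_if_finite[of "S - D" rank] finite_dominating_set[OF dom] by blast
    then obtain t where twin_t: "t \<in> V - D" "t \<noteq> s" "center t = center s"
      and smaller: "\<And>u. u \<in> V - D \<Longrightarrow> {u, t} \<in> E \<Longrightarrow> rank u < rank s"
      using ex_lower_twin[of s] s_in \<open>S \<subseteq> V\<close> unfolding lower_twin_def by blast
    have same_star: "v = s" if "v \<in> S" "center v = center s" for v
      using inj_onD[OF inj_on_center_minimum_dominating_set[OF mds] that(2)] that(1) s_in by blast
    then have "t \<notin> S"
      using twin_t by blast
    then obtain u where dominator: "u \<in> S" "{u, t} \<in> E"
      using dom twin_t(1) by (auto simp: dominating_set_def)
    show False
    proof (cases "u \<in> D")
      case True
      then have "u = s"
        using dominator twin_t adjacent_D_iff center_of_D same_star by auto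
      then show False using True s_in by simp
    next
      case False
      then show False using least smaller dominator \<open>S \<subseteq> V\<close> by blast
    qed
  qed
  then show ?thesis
    using card_eq D_subset_V finite_V by (intro card_subset_eq) (auto intro: finite_subset)
qed

lemma no_isolated_verticesI:
  assumes "D \<subseteq> center ` (V - D)"
  shows "no_isolated_vertices V E"
  unfolding no_isolated_vertices_def
proof
  fix v assume v: "v \<in> V"
  show "\<exists>y\<in>V. {v, y} \<in> E"
  proof (cases "v \<in> D")
    case True
    then obtain y where "y \<in> V - D" "center y = v"
      using assms by blast
    then show ?thesis using True adjacent_D_iff by blast
  next
    case False
    then have "{center v, v} \<in> E"
      using v adjacent_D_iff center_in_D by blast
    then show ?thesis using v center_in_D D_subset_V by (metis insert_commute subsetD)
  qed
qed

lemma sum_degree_D: "(\<Sum>u\<in>D. degree V E u) = card V - card D"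
proof -
  have "finite D"
    using D_subset_V finite_V finite_subset by blast
  have "(\<Sum>u\<in>D. degree V E u) = (\<Sum>u\<in>D. card {v \<in> V - D. center v = u})"
    unfolding degree_def
    by (intro sum.cong refl arg_cong[where f = card]) (auto simp: adjacent_D_iff)
  also have "\<dots> = card (V - D)"
    using sum.group[of "V - D" D center "\<lambda>_. 1 :: nat"] finite_V \<open>finite D\<close> center_in_D by auto
  also have "\<dots> = card V - card D"
    using D_subset_V \<open>finite D\<close> by (rule card_Diff_subset[rotated])
  finally show ?thesis .
qed

lemma perfectly_dominatedI:
  assumes "simple_graph V E" and "no_isolated_vertices V E"
  shows "perfectly_dominated V E"
  using assms minimum_dominating_set_D sum_degree_D
  by (auto simp: perfectly_dominated_def domination_number_eq)

end

section \<open>The graph\<close>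

text \<open>The vertices \<open>x\<^sub>i\<close>, \<open>c\<^sub>i\<close>, \<open>l\<^sub>t\<close> are encoded as \<open>i\<close>, \<open>\<gamma> + i\<close>, \<open>2\<gamma> + t\<close>.\<close>

locale star_clique_graph =
  fixes n \<gamma> :: nat
  assumes \<gamma>_pos: "0 < \<gamma>" and order_ge: "3 * \<gamma> \<le> n"
begin

definition center :: "nat \<Rightarrow> nat" where
  "center v =
     (if v < \<gamma> then v else if v < 2 * \<gamma> then v - \<gamma> else min (v - 2 * \<gamma>) (\<gamma> - 1))"

definition star_edges :: "nat set set" where
  "star_edges = (\<lambda>v. {center v, v}) ` {\<gamma>..<n}"

definition clique_edges :: "nat set set" where
  "clique_edges = {e. e \<subseteq> {2 * \<gamma>..<n} \<and> card e = 2}"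

definition half_graph_edges :: "nat set set" where
  "half_graph_edges = (\<lambda>(v, i). {\<gamma> + i, v}) ` (SIGMA v:{2 * \<gamma>..<n}. {..<center v})"

definition edges :: "nat set set" where
  "edges = star_edges \<union> (clique_edges \<union> half_graph_edges)"

lemma center_less: "center v < \<gamma>"
  using \<gamma>_pos by (auto simp: center_def)

lemma simple_graph_edges: "simple_graph {..<n} edges"
proof -
  have "star_edges \<subseteq> {e. e \<subseteq> {..<n} \<and> card e = 2}"
  proof -
    have "{center v, v} \<subseteq> {..<n} \<and> card {center v, v} = 2" if "v \<in> {\<gamma>..<n}" for v
      using that center_less[of v] by auto
    then show ?thesis
      by (auto simp: star_edges_def)
  qed
  moreover have "clique_edges \<subseteq> {e. e \<subseteq> {..<n} \<and> card e = 2}"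
    by (auto simp: clique_edges_def)
  moreover have "half_graph_edges \<subseteq> {e. e \<subseteq> {..<n} \<and> card e = 2}"
  proof -
    have "{\<gamma> + i, v} \<subseteq> {..<n} \<and> card {\<gamma> + i, v} = 2"
      if "v \<in> {2 * \<gamma>..<n}" "i < center v" for v i
      using that center_less[of v] by auto
    then show ?thesis
      by (auto simp: half_graph_edges_def)
  qed
  ultimately show ?thesis
    by (simp add: simple_graph_def edges_def)
qed

lemma adjacent_center_iff:
  assumes "i < \<gamma>" and "v < n"
  shows "{i, v} \<in> edges \<longleftrightarrow> \<gamma> \<le> v \<and> center v = i"
proof -
  have "{i, v} \<in> star_edges \<longleftrightarrow> \<gamma> \<le> v \<and> center v = i"
    using assms by (auto simp: star_edges_def doubleton_eq_iff)
  moreover have "{i, v} \<notin> clique_edges \<union> half_graph_edges"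
    using assms by (auto simp: clique_edges_def half_graph_edges_def doubleton_eq_iff)
  ultimately show ?thesis
    by (simp add: edges_def)
qed

sublocale efficient_domination "{..<n}" edges "{..<\<gamma>}" center
proof
  show "center v \<in> {..<\<gamma>}" for v
    using center_less by simp
qed (use order_ge adjacent_center_iff in \<open>auto simp: center_def\<close>)

lemma adjacent_half_graph_iff:
  assumes "v \<in> {\<gamma>..<n}" and "i < \<gamma>"
  shows "{v, \<gamma> + i} \<in> edges \<longleftrightarrow> 2 * \<gamma> \<le> v \<and> i < center v"
proof -
  have "{v, \<gamma> + i} \<noteq> {center w, w}" for w
    using assms center_less[of w] by (auto simp: doubleton_eq_iff)
  then have "{v, \<gamma> + i} \<notin> star_edges"
    by (auto simp: star_edges_def)
  moreover have "{v, \<gamma> + i} \<notin> clique_edges"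
    using assms by (auto simp: clique_edges_def)
  moreover have "{v, \<gamma> + i} \<in> half_graph_edges \<longleftrightarrow> 2 * \<gamma> \<le> v \<and> i < center v"
    using assms by (force simp: half_graph_edges_def doubleton_eq_iff)
  ultimately show ?thesis
    by (simp add: edges_def)
qed

definition rank :: "nat \<Rightarrow> int" where
  "rank v = (if v < 2 * \<gamma> then int v else - int (center v))"

lemma lower_twin_half_graph_vertex:
  assumes "i < \<gamma>"
  shows "lower_twin rank (\<gamma> + i) (2 * \<gamma> + i)"
proof -
  have twin_center: "center (2 * \<gamma> + i) = i"
    using assms by (simp add: center_def)
  have "rank u < rank (\<gamma> + i)" if "\<gamma> \<le> u" "{u, 2 * \<gamma> + i} \<in> edges" for u
  proof (cases "u < 2 * \<gamma>")
    case True
    then have "u - \<gamma> < i"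
      using adjacent_half_graph_iff[of "2 * \<gamma> + i" "u - \<gamma>"] twin_center that assms order_ge
      by (simp add: insert_commute)
    then show ?thesis using True assms by (simp add: rank_def)
  next
    case False
    then show ?thesis using assms by (simp add: rank_def)
  qed
  then show ?thesis
    using assms order_ge twin_center by (auto simp: lower_twin_def center_def)
qed

lemma lower_twin_clique_vertex:
  assumes "s \<in> {2 * \<gamma>..<n}"
  shows "lower_twin rank s (\<gamma> + center s)"
proof -
  have "rank u < rank s" if "u \<in> {\<gamma>..<n}" "{u, \<gamma> + center s} \<in> edges" for u
    using that assms adjacent_half_graph_iff[OF that(1) center_less[of s]]
    by (simp add: rank_def)
  moreover have "center (\<gamma> + center s) = center s"
    using center_less[of s] by (simp add: center_def)
  ultimately show ?thesis
    using assms center_less[of s] order_ge by (auto simp: lower_twin_def)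
qed

lemma minimum_dominating_set_iff:
  "minimum_dominating_set {..<n} edges S \<longleftrightarrow> S = {..<\<gamma>}"
proof -
  have "\<exists>t. lower_twin rank s t" if "s \<in> {..<n} - {..<\<gamma>}" for s
  proof (cases "s < 2 * \<gamma>")
    case True
    then have "lower_twin rank s (2 * \<gamma> + (s - \<gamma>))"
      using that lower_twin_half_graph_vertex[of "s - \<gamma>"] by simp
    then show ?thesis ..
  next
    case False
    then show ?thesis
      using that lower_twin_clique_vertex[of s] by auto
  qed
  then show ?thesis
    using minimum_dominating_set_unique minimum_dominating_set_D by blast
qed

lemma no_isolated_vertices_edges: "no_isolated_vertices {..<n} edges"
proof (rule no_isolated_verticesI)
  show "{..<\<gamma>} \<subseteq> center ` ({..<n} - {..<\<gamma>})"
  proof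
    fix i assume "i \<in> {..<\<gamma>}"
    then show "i \<in> center ` ({..<n} - {..<\<gamma>})"
      using order_ge by (intro image_eqI[of _ _ "\<gamma> + i"]) (auto simp: center_def)
  qed
qed

lemma in_unique_mds_graphs: "({..<n}, edges) \<in> unique_mds_graphs n \<gamma>"
  by (auto simp: unique_mds_graphs_def simple_graph_edges no_isolated_vertices_edges
      domination_number_eq minimum_dominating_set_iff)

end

section \<open>The number of edges\<close>

lemma choose_two_add: "(m + k) choose 2 = (m choose 2) + m * k + (k choose 2)"
  by (induction k) (auto simp: numeral_2_eq_2)

lemma sum_min_lessThan: "(\<Sum>t<Suc d + k. min t d) = (Suc d choose 2) + k * d"
proof (induction k)
  case 0
  have "(\<Sum>t<Suc d. min t d) = \<Sum>{0..d}"
    by (intro sum.cong) auto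
  then show ?case by (simp add: gauss_sum_nat choose_two mult.commute)
qed simp

context star_clique_graph
begin

lemma card_star_edges: "card star_edges = n - \<gamma>"
proof -
  have "inj_on (\<lambda>v. {center v, v}) {\<gamma>..<n}"
    by (auto simp: inj_on_def doubleton_eq_iff) (metis center_less not_le)
  then show ?thesis
    by (simp add: star_edges_def card_image)
qed

lemma card_clique_edges: "card clique_edges = (n - 2 * \<gamma>) choose 2"
  by (simp add: clique_edges_def n_subsets)

lemma card_half_graph_edges: "card half_graph_edges = (\<gamma> choose 2) + (n - 3 * \<gamma>) * (\<gamma> - 1)"
proof -
  have "inj_on (\<lambda>(v, i). {\<gamma> + i, v}) (SIGMA v:{2 * \<gamma>..<n}. {..<center v})"
    by (auto simp: inj_on_def doubleton_eq_iff dest: less_trans[OF _ center_less])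
  then have "card half_graph_edges = (\<Sum>v = 2 * \<gamma>..<n. center v)"
    by (simp add: half_graph_edges_def card_image)
  also have "\<dots> = (\<Sum>t<n - 2 * \<gamma>. min t (\<gamma> - 1))"
    by (rule sum.reindex_bij_witness[of _ "\<lambda>t. 2 * \<gamma> + t" "\<lambda>v. v - 2 * \<gamma>"])
      (auto simp: center_def)
  also have "\<dots> = (\<gamma> choose 2) + (n - 3 * \<gamma>) * (\<gamma> - 1)"
    using sum_min_lessThan[of "\<gamma> - 1" "n - 3 * \<gamma>"] \<gamma>_pos order_ge by simp
  finally show ?thesis .
qed

lemma card_edges_eq_sum:
  "card edges = card star_edges + card clique_edges + card half_graph_edges"
proof -
  have finite_edges: "finite star_edges" "finite clique_edges" "finite half_graph_edges"
    by (simp_all add: star_edges_def clique_edges_def half_graph_edges_def)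
  have "star_edges \<inter> Pow {\<gamma>..<n} = {}"
    using center_less by (auto simp: star_edges_def simp flip: not_le)
  moreover have "clique_edges \<union> half_graph_edges \<subseteq> Pow {\<gamma>..<n}"
    by (auto simp: clique_edges_def half_graph_edges_def dest: less_trans[OF _ center_less])
  ultimately have "star_edges \<inter> (clique_edges \<union> half_graph_edges) = {}"
    by blast
  moreover have "clique_edges \<inter> half_graph_edges = {}"
    by (auto simp: clique_edges_def half_graph_edges_def dest: less_trans[OF _ center_less])
  ultimately show ?thesis
    using finite_edges by (simp add: edges_def card_Un_disjoint)
qed

lemma card_edges: "int (card edges) = int ((n - \<gamma>) choose 2) - int \<gamma> * (int \<gamma> - 2)"
proof -
  obtain k where n_eq: "n = 3 * \<gamma> + k"
    using order_ge le_Suc_ex by blast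
  have "n - \<gamma> = \<gamma> + k + \<gamma>" "n - 2 * \<gamma> = \<gamma> + k" "n - 3 * \<gamma> = k"
    by (simp_all add: n_eq)
  then have "card edges = 2 * \<gamma> + k + ((\<gamma> + k) choose 2) + ((\<gamma> choose 2) + k * (\<gamma> - 1))"
    by (simp add: card_edges_eq_sum card_star_edges card_clique_edges card_half_graph_edges)
  moreover have "(n - \<gamma>) choose 2 = ((\<gamma> + k) choose 2) + (\<gamma> + k) * \<gamma> + (\<gamma> choose 2)"
    using choose_two_add[of "\<gamma> + k" \<gamma>] by (simp add: \<open>n - \<gamma> = \<gamma> + k + \<gamma>\<close>)
  ultimately show ?thesis
    using \<gamma>_pos by (cases \<gamma>) (simp_all add: algebra_simps)
qed

end

theorem theorem2p12:
  fixes n \<gamma> :: nat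
  assumes "\<gamma> \<ge> 2" and "n \<ge> 3 * \<gamma>"
  shows "\<exists>(V :: nat set) E. (V, E) \<in> unique_mds_graphs n \<gamma> \<and> perfectly_dominated V E \<and>
           int (card E) = int ((n - \<gamma>) choose 2) - int \<gamma> * (int \<gamma> - 2)"
proof -
  interpret star_clique_graph n \<gamma>
    using assms by unfold_locales auto
  have "perfectly_dominated {..<n} edges"
    using simple_graph_edges no_isolated_vertices_edges by (rule perfectly_dominatedI)
  then show ?thesis
    using in_unique_mds_graphs card_edges by blast
qed

end
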